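(* Fix an integration structure $((\Omega,\mathcal H),\mathfrak N,((X,\eta_1),(Y,\eta_2),(Z,\eta_3);\bullet))$ and a set function $\mu:\mathcal H\to Y$. If $f:\Omega\to X$ is net Riemann integrable on $A\in\mathcal H$ with respect to $\mu$, then (with the class $\mathcal C_{f,A}=\{A\}$) $f$ is Saks integrable on $A$ and the two integrals agree: $$\int_A^{Sa}f\,d\mu=\int_A f\,d\mu .$$
   Context: A net convergence structure $\eta$ on a set $V$ assigns to each $v\in V$ a class $\eta(v)$ of nets in $V$ (those "converging to $v$") such that: (i) constant nets equal to $v$ converge to $v$; (ii) every quasi-subnet of a net converging to $v$ converges to $v$, where $(y_j)_{j\in J}$ is a quasi-subnet of $(x_i)_{i\in I}$ if for every $i_0\in I$ there is $j_0\in J$ with $\{y_j:j\ge j_0\}\subseteq\{x_i:i\ge i_0\}$; (iii) if $(x_i)_{i\in I}$ and $(y_i)_{i\in I}$ converge to $v$ and $z_i\in\{x_i,y_i\}$ for all $i$, then $(z_i)$ converges to $v$. Standing assumptions: vector spaces are real; all net convergence structures are Hausdorff (limits are unique); on a vector space, addition and multiplication by each fixed real number are continuous (preserve convergence of nets). A paved space $(\Omega,\mathcal H)$ is a nonempty set $\Omega$ with a collection $\mathcal H$ of subsets with $\emptyset\in\mathcal H$. For each $A\in\mathcal H$ a Fleischer–Szabó–Száz net $\{(\sigma_\gamma,\tau_\gamma)\}_{\gamma\in\Gamma_A}$ is given: $\Gamma_A$ is a directed set and $\sigma_\gamma=\{\sigma_{\gamma_i}\}_{i\in I_\gamma}$,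 $\tau_\gamma=\{\tau_{\gamma_i}\}_{i\in I_\gamma}$ are finite families in $\mathcal H$ and $\Omega$ respectively. An integration structure consists of $(\Omega,\mathcal H)$, these nets $\mathfrak N$, and vector spaces with net convergence structures connected by a bilinear product $\bullet:X\times Y\to Z$ (a bilinear map, written by juxtaposition, continuous in each argument separately). $f$ is net Riemann integrable on $A$ if $\int_Af\,d\mu:=\lim_{\gamma\in\Gamma_A}\sum_{i\in I_\gamma}f(\tau_{\gamma_i})\mu(\sigma_{\gamma_i})$ exists in $(Z,\eta_3)$. Saks integral: for $A\in\mathcal H$ let a non-empty class $\mathcal C_{f,A}\subseteq\mathcal H$, upwards directed by inclusion, be given such that $f$ is net Riemann integrable on each $B\in\mathcal C_{f,A}$. $f$ is Saks integrable on $A$ if the net $\{\int_Bf\,d\mu\}_{B\in\mathcal C_{f,A}}$ has a limit in $(Z,\eta_3)$, and then $\int_A^{Sa}f\,d\mu:=\lim_{B\in\mathcal C_{f,A}}\int_Bf\,d\mu$. *)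

theory Defs
  imports "HOL-Analysis.Analysis"
begin

section \<open>Nets\<close>

text \<open>A pair \<open>(i, j)\<close> in the relation means that \<open>i\<close> precedes \<open>j\<close>.\<close>

definition directed_set :: "'i set \<Rightarrow> ('i \<times> 'i) set \<Rightarrow> bool" where
  "directed_set I r \<longleftrightarrow> I \<noteq> {} \<and> preorder_on I r \<and>
     (\<forall>i\<in>I. \<forall>j\<in>I. \<exists>k\<in>I. (i, k) \<in> r \<and> (j, k) \<in> r)"

record ('i, 'v) net =
  net_idx :: "'i set"
  net_le :: "('i \<times> 'i) set"
  net_at :: "'i \<Rightarrow> 'v"

definition is_net :: "('i, 'v) net \<Rightarrow> bool" where
  "is_net x \<longleftrightarrow> directed_set (net_idx x) (net_le x)"

definition net_tail :: "('i, 'v) net \<Rightarrow> 'i \<Rightarrow> 'v set" where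
  "net_tail x i = net_at x ` {j \<in> net_idx x. (i, j) \<in> net_le x}"

definition quasi_subnet :: "('j, 'v) net \<Rightarrow> ('i, 'v) net \<Rightarrow> bool" where
  "quasi_subnet y x \<longleftrightarrow>
     (\<forall>i\<in>net_idx x. \<exists>j\<in>net_idx y. net_tail y j \<subseteq> net_tail x i)"

definition map_net :: "('v \<Rightarrow> 'w) \<Rightarrow> ('i, 'v) net \<Rightarrow> ('i, 'w) net" where
  "map_net h x = \<lparr>net_idx = net_idx x, net_le = net_le x, net_at = h \<circ> net_at x\<rparr>"

definition add_net :: "('i, 'v::plus) net \<Rightarrow> ('i, 'v) net \<Rightarrow> ('i, 'v) net" where
  "add_net x y = \<lparr>net_idx = net_idx x, net_le = net_le x, net_at = (\<lambda>i. net_at x i + net_at y i)\<rparr>"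


section \<open>Net convergence structures\<close>

text \<open>
  The proper class of all nets is replaced by the nets whose index set is a subset of the type
  \<open>'i\<close>, which is arbitrary and plays the role of a universe of index sets.
  The values of \<open>net_at\<close> outside \<open>net_idx\<close> are irrelevant: two nets which
  differ only there are quasi-subnets of each other.
\<close>

definition net_convergence :: "('v \<Rightarrow> ('i, 'v) net set) \<Rightarrow> bool" where
  "net_convergence \<eta> \<longleftrightarrow>
     (\<forall>v. \<forall>x\<in>\<eta> v. is_net x) \<and>
     (\<forall>v x. is_net x \<longrightarrow> (\<forall>i\<in>net_idx x. net_at x i = v) \<longrightarrow> x \<in> \<eta> v) \<and>
     (\<forall>v x y. x \<in> \<eta> v \<longrightarrow> is_net y \<longrightarrow> quasi_subnet y x \<longrightarrow> y \<in> \<eta> v) \<and>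
     (\<forall>v x y z. x \<in> \<eta> v \<longrightarrow> y \<in> \<eta> v \<longrightarrow> is_net z \<longrightarrow>
        net_idx x = net_idx z \<longrightarrow> net_le x = net_le z \<longrightarrow>
        net_idx y = net_idx z \<longrightarrow> net_le y = net_le z \<longrightarrow>
        (\<forall>i\<in>net_idx z. net_at z i \<in> {net_at x i, net_at y i}) \<longrightarrow> z \<in> \<eta> v)"

definition net_hausdorff :: "('v \<Rightarrow> ('i, 'v) net set) \<Rightarrow> bool" where
  "net_hausdorff \<eta> \<longleftrightarrow> (\<forall>v w x. x \<in> \<eta> v \<longrightarrow> x \<in> \<eta> w \<longrightarrow> v = w)"

definition convergence_vector_space :: "('v::real_vector \<Rightarrow> ('i, 'v) net set) \<Rightarrow> bool" where
  "convergence_vector_space \<eta> \<longleftrightarrow>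
     net_convergence \<eta> \<and> net_hausdorff \<eta> \<and>
     (\<forall>v w x y. x \<in> \<eta> v \<longrightarrow> y \<in> \<eta> w \<longrightarrow> net_idx x = net_idx y \<longrightarrow> net_le x = net_le y \<longrightarrow>
        add_net x y \<in> \<eta> (v + w)) \<and>
     (\<forall>(c::real) v x. x \<in> \<eta> v \<longrightarrow> map_net (\<lambda>u. c *\<^sub>R u) x \<in> \<eta> (c *\<^sub>R v))"

definition net_continuous ::
    "('v \<Rightarrow> ('i, 'v) net set) \<Rightarrow> ('w \<Rightarrow> ('i, 'w) net set) \<Rightarrow> ('v \<Rightarrow> 'w) \<Rightarrow> bool" where
  "net_continuous \<eta> \<theta> h \<longleftrightarrow> (\<forall>v. \<forall>x\<in>\<eta> v. map_net h x \<in> \<theta> (h v))"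

text \<open>
  Nets occur below whose index set is a family of subsets of \<open>\<Omega>\<close>, hence lives in another
  type than \<open>'i\<close>. Such a net converges to \<open>v\<close> if a copy of it with indices in
  \<open>'i\<close> does. For nets which are already indexed in \<open>'i\<close> this is membership in
  \<open>\<eta> v\<close>, as proved in \<open>converges_iff\<close>. The choice of the copy is immaterial, since any two
  are quasi-subnets of each other; there is a copy for every such net as soon as \<open>'i\<close> is
  at least as large as the type of sets of points of \<open>\<Omega>\<close>.
\<close>

definition reindex_net :: "('j \<Rightarrow> 'i) \<Rightarrow> ('j, 'v) net \<Rightarrow> ('i, 'v) net" where
  "reindex_net e x =
     \<lparr>net_idx = e ` net_idx x,
      net_le = map_prod e e ` net_le x,
      net_at = net_at x \<circ> inv_into (net_idx x) e\<rparr>"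

definition converges :: "('v \<Rightarrow> ('i, 'v) net set) \<Rightarrow> ('j, 'v) net \<Rightarrow> 'v \<Rightarrow> bool" where
  "converges \<eta> x v \<longleftrightarrow>
     is_net x \<and> (\<exists>e. inj_on e (net_idx x) \<and> reindex_net e x \<in> \<eta> v)"

definition net_lim :: "('v \<Rightarrow> ('i, 'v) net set) \<Rightarrow> ('j, 'v) net \<Rightarrow> 'v" where
  "net_lim \<eta> x = (THE v. converges \<eta> x v)"

lemma net_tail_reindex:
  assumes "is_net x" and "inj_on e (net_idx x)" and "i \<in> net_idx x"
  shows "net_tail (reindex_net e x) (e i) = net_tail x i"
proof -
  have sub: "net_le x \<subseteq> net_idx x \<times> net_idx x"
    using assms(1) by (simp add: is_net_def directed_set_def preorder_on_def)
  have idx: "{k \<in> e ` net_idx x. (e i, k) \<in> map_prod e e ` net_le x}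
      = e ` {j \<in> net_idx x. (i, j) \<in> net_le x}"
  proof (intro equalityI subsetI)
    fix k assume "k \<in> {k \<in> e ` net_idx x. (e i, k) \<in> map_prod e e ` net_le x}"
    then obtain a b where ab: "(a, b) \<in> net_le x" "e i = e a" "k = e b"
      by auto
    then have "a \<in> net_idx x" "b \<in> net_idx x"
      using sub by auto
    with ab assms(2,3) have "a = i"
      by (metis inj_onD)
    with ab \<open>b \<in> net_idx x\<close> show "k \<in> e ` {j \<in> net_idx x. (i, j) \<in> net_le x}"
      by blast
  next
    fix k assume "k \<in> e ` {j \<in> net_idx x. (i, j) \<in> net_le x}"
    then obtain j where j: "j \<in> net_idx x" "(i, j) \<in> net_le x" "k = e j"
      by blast
    then have "map_prod e e (i, j) \<in> map_prod e e ` net_le x"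
      by (intro imageI)
    with j show "k \<in> {k \<in> e ` net_idx x. (e i, k) \<in> map_prod e e ` net_le x}"
      by simp
  qed
  have "(net_at x \<circ> inv_into (net_idx x) e) ` e ` {j \<in> net_idx x. (i, j) \<in> net_le x}
      = net_at x ` {j \<in> net_idx x. (i, j) \<in> net_le x}"
    unfolding image_image by (intro image_cong) (simp_all add: inv_into_f_f[OF assms(2)])
  then show ?thesis
    unfolding net_tail_def reindex_net_def by (simp add: idx)
qed

lemma net_convergence_is_net:
  assumes "net_convergence \<eta>" and "x \<in> \<eta> v"
  shows "is_net x"
  using conjunct1[OF assms(1)[unfolded net_convergence_def]] assms(2) by blast

lemma net_convergence_quasi_subnet:
  assumes "net_convergence \<eta>" and "x \<in> \<eta> v" and "is_net y" and "quasi_subnet y x"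
  shows "y \<in> \<eta> v"
  using assms(1)[unfolded net_convergence_def, THEN conjunct2, THEN conjunct2, THEN conjunct1]
    assms(2-4) by blast

lemma converges_iff:
  fixes x :: "('i, 'v) net" and \<eta> :: "'v \<Rightarrow> ('i, 'v) net set"
  assumes "net_convergence \<eta>"
  shows "converges \<eta> x v \<longleftrightarrow> x \<in> \<eta> v"
proof
  assume "x \<in> \<eta> v"
  then have n: "is_net x"
    by (rule net_convergence_is_net[OF assms])
  have r: "is_net (reindex_net id x)"
    using n by (simp add: is_net_def reindex_net_def map_prod.id)
  have "quasi_subnet (reindex_net id x) x"
    unfolding quasi_subnet_def
  proof
    fix i assume i: "i \<in> net_idx x"
    then have "net_tail (reindex_net id x) i = net_tail x i"
      using net_tail_reindex[OF n inj_on_id i] by simp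
    moreover have "i \<in> net_idx (reindex_net id x)"
      using i by (simp add: reindex_net_def)
    ultimately show "\<exists>j\<in>net_idx (reindex_net id x). net_tail (reindex_net id x) j \<subseteq> net_tail x i"
      by blast
  qed
  then have "reindex_net id x \<in> \<eta> v"
    using net_convergence_quasi_subnet[OF assms \<open>x \<in> \<eta> v\<close> r] by blast
  then show "converges \<eta> x v"
    using n inj_on_id unfolding converges_def by blast
next
  assume "converges \<eta> x v"
  then obtain e where n: "is_net x" and e: "inj_on e (net_idx x)" "reindex_net e x \<in> \<eta> v"
    by (auto simp: converges_def)
  have "quasi_subnet x (reindex_net e x)"
    unfolding quasi_subnet_def
  proof
    fix k assume "k \<in> net_idx (reindex_net e x)"
    then obtain i where i: "i \<in> net_idx x" "k = e i"
      by (auto simp: reindex_net_def)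
    then show "\<exists>j\<in>net_idx x. net_tail x j \<subseteq> net_tail (reindex_net e x) k"
      using net_tail_reindex[OF n e(1) i(1)] by blast
  qed
  then show "x \<in> \<eta> v"
    by (rule net_convergence_quasi_subnet[OF assms e(2) n])
qed


section \<open>Integration structures\<close>

definition paved_space :: "'a set \<Rightarrow> 'a set set \<Rightarrow> bool" where
  "paved_space \<Omega> \<H> \<longleftrightarrow> \<Omega> \<noteq> {} \<and> \<H> \<subseteq> Pow \<Omega> \<and> {} \<in> \<H>"

text \<open>
  Fleischer--Szabo--Szaz nets: for an index \<open>\<gamma>\<close> in \<open>fss_idx\<close>, the families
  \<open>\<sigma>\<^sub>\<gamma>\<close> and \<open>\<tau>\<^sub>\<gamma>\<close> are the restrictions of \<open>fss_set \<gamma>\<close> and \<open>fss_tag \<gamma>\<close> to the finite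
  set \<open>fss_fam \<gamma>\<close>.
\<close>

record ('i, 'k, 'a) fss_net =
  fss_idx :: "'i set"
  fss_le :: "('i \<times> 'i) set"
  fss_fam :: "'i \<Rightarrow> 'k set"
  fss_set :: "'i \<Rightarrow> 'k \<Rightarrow> 'a set"
  fss_tag :: "'i \<Rightarrow> 'k \<Rightarrow> 'a"

definition is_fss_net :: "'a set \<Rightarrow> 'a set set \<Rightarrow> ('i, 'k, 'a) fss_net \<Rightarrow> bool" where
  "is_fss_net \<Omega> \<H> N \<longleftrightarrow>
     directed_set (fss_idx N) (fss_le N) \<and>
     (\<forall>\<gamma>\<in>fss_idx N. finite (fss_fam N \<gamma>) \<and>
        (\<forall>i\<in>fss_fam N \<gamma>. fss_set N \<gamma> i \<in> \<H> \<and> fss_tag N \<gamma> i \<in> \<Omega>))"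

definition integration_structure ::
    "'a set \<Rightarrow> 'a set set \<Rightarrow> ('a set \<Rightarrow> ('i, 'k, 'a) fss_net) \<Rightarrow>
     ('x::real_vector \<Rightarrow> ('i, 'x) net set) \<Rightarrow>
     ('y::real_vector \<Rightarrow> ('i, 'y) net set) \<Rightarrow>
     ('z::real_vector \<Rightarrow> ('i, 'z) net set) \<Rightarrow> ('x \<Rightarrow> 'y \<Rightarrow> 'z) \<Rightarrow> bool" where
  "integration_structure \<Omega> \<H> \<N> \<eta>1 \<eta>2 \<eta>3 bul \<longleftrightarrow>
     paved_space \<Omega> \<H> \<and>
     (\<forall>A\<in>\<H>. is_fss_net \<Omega> \<H> (\<N> A)) \<and>
     convergence_vector_space \<eta>1 \<and>
     convergence_vector_space \<eta>2 \<and>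
     convergence_vector_space \<eta>3 \<and>
     bilinear bul \<and>
     (\<forall>u. net_continuous \<eta>2 \<eta>3 (\<lambda>w. bul u w)) \<and>
     (\<forall>w. net_continuous \<eta>1 \<eta>3 (\<lambda>u. bul u w))"


section \<open>The net Riemann integral and the Saks integral\<close>

text \<open>
  A function on \<open>\<Omega>\<close> and a set function on \<open>\<H>\<close> are total functions of which only the values
  on \<open>\<Omega>\<close> and \<open>\<H>\<close> are used.
\<close>

definition riemann_net ::
    "('a set \<Rightarrow> ('i, 'k, 'a) fss_net) \<Rightarrow> ('x \<Rightarrow> 'y \<Rightarrow> 'z::real_vector) \<Rightarrow>
     ('a set \<Rightarrow> 'y) \<Rightarrow> ('a \<Rightarrow> 'x) \<Rightarrow> 'a set \<Rightarrow> ('i, 'z) net" where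
  "riemann_net \<N> bul \<mu> f A =
     \<lparr>net_idx = fss_idx (\<N> A),
      net_le = fss_le (\<N> A),
      net_at = (\<lambda>\<gamma>. \<Sum>i\<in>fss_fam (\<N> A) \<gamma>. bul (f (fss_tag (\<N> A) \<gamma> i)) (\<mu> (fss_set (\<N> A) \<gamma> i)))\<rparr>"

definition riemann_integrable ::
    "('a set \<Rightarrow> ('i, 'k, 'a) fss_net) \<Rightarrow> ('z::real_vector \<Rightarrow> ('i, 'z) net set) \<Rightarrow>
     ('x \<Rightarrow> 'y \<Rightarrow> 'z) \<Rightarrow> ('a set \<Rightarrow> 'y) \<Rightarrow> ('a \<Rightarrow> 'x) \<Rightarrow> 'a set \<Rightarrow> bool" where
  "riemann_integrable \<N> \<eta>3 bul \<mu> f A \<longleftrightarrow> (\<exists>z. converges \<eta>3 (riemann_net \<N> bul \<mu> f A) z)"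

definition riemann_integral ::
    "('a set \<Rightarrow> ('i, 'k, 'a) fss_net) \<Rightarrow> ('z::real_vector \<Rightarrow> ('i, 'z) net set) \<Rightarrow>
     ('x \<Rightarrow> 'y \<Rightarrow> 'z) \<Rightarrow> ('a set \<Rightarrow> 'y) \<Rightarrow> ('a \<Rightarrow> 'x) \<Rightarrow> 'a set \<Rightarrow> 'z" where
  "riemann_integral \<N> \<eta>3 bul \<mu> f A = net_lim \<eta>3 (riemann_net \<N> bul \<mu> f A)"

text \<open>The family \<open>\<C>\<close> assigns to \<open>f\<close> and \<open>A\<close> the class \<open>\<C> f A\<close> over which the limit is taken.\<close>

definition saks_class ::
    "'a set set \<Rightarrow> ('a set \<Rightarrow> ('i, 'k, 'a) fss_net) \<Rightarrow> ('z::real_vector \<Rightarrow> ('i, 'z) net set) \<Rightarrow>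
     ('x \<Rightarrow> 'y \<Rightarrow> 'z) \<Rightarrow> ('a set \<Rightarrow> 'y) \<Rightarrow> ('a \<Rightarrow> 'x) \<Rightarrow> 'a set set \<Rightarrow> bool" where
  "saks_class \<H> \<N> \<eta>3 bul \<mu> f \<K> \<longleftrightarrow>
     \<K> \<noteq> {} \<and> \<K> \<subseteq> \<H> \<and>
     (\<forall>B\<in>\<K>. \<forall>B'\<in>\<K>. \<exists>D\<in>\<K>. B \<subseteq> D \<and> B' \<subseteq> D) \<and>
     (\<forall>B\<in>\<K>. riemann_integrable \<N> \<eta>3 bul \<mu> f B)"

definition saks_net ::
    "('a set \<Rightarrow> ('i, 'k, 'a) fss_net) \<Rightarrow> ('z::real_vector \<Rightarrow> ('i, 'z) net set) \<Rightarrow>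
     ('x \<Rightarrow> 'y \<Rightarrow> 'z) \<Rightarrow> ('a set \<Rightarrow> 'y) \<Rightarrow> ('a \<Rightarrow> 'x) \<Rightarrow> 'a set set \<Rightarrow> ('a set, 'z) net" where
  "saks_net \<N> \<eta>3 bul \<mu> f \<K> =
     \<lparr>net_idx = \<K>,
      net_le = {(B, B'). B \<in> \<K> \<and> B' \<in> \<K> \<and> B \<subseteq> B'},
      net_at = (\<lambda>B. riemann_integral \<N> \<eta>3 bul \<mu> f B)\<rparr>"

definition saks_integrable ::
    "'a set set \<Rightarrow> ('a set \<Rightarrow> ('i, 'k, 'a) fss_net) \<Rightarrow> ('z::real_vector \<Rightarrow> ('i, 'z) net set) \<Rightarrow>
     ('x \<Rightarrow> 'y \<Rightarrow> 'z) \<Rightarrow> ('a set \<Rightarrow> 'y) \<Rightarrow> (('a \<Rightarrow> 'x) \<Rightarrow> 'a set \<Rightarrow> 'a set set) \<Rightarrow>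
     ('a \<Rightarrow> 'x) \<Rightarrow> 'a set \<Rightarrow> bool" where
  "saks_integrable \<H> \<N> \<eta>3 bul \<mu> \<C> f A \<longleftrightarrow>
     saks_class \<H> \<N> \<eta>3 bul \<mu> f (\<C> f A) \<and>
     (\<exists>z. converges \<eta>3 (saks_net \<N> \<eta>3 bul \<mu> f (\<C> f A)) z)"

definition saks_integral ::
    "('a set \<Rightarrow> ('i, 'k, 'a) fss_net) \<Rightarrow> ('z::real_vector \<Rightarrow> ('i, 'z) net set) \<Rightarrow>
     ('x \<Rightarrow> 'y \<Rightarrow> 'z) \<Rightarrow> ('a set \<Rightarrow> 'y) \<Rightarrow> (('a \<Rightarrow> 'x) \<Rightarrow> 'a set \<Rightarrow> 'a set set) \<Rightarrow>
     ('a \<Rightarrow> 'x) \<Rightarrow> 'a set \<Rightarrow> 'z" where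
  "saks_integral \<N> \<eta>3 bul \<mu> \<C> f A = net_lim \<eta>3 (saks_net \<N> \<eta>3 bul \<mu> f (\<C> f A))"

end

theory Submission
  imports Defs
begin

text \<open>
  The Saks net over the class \<open>{A}\<close> has the single index \<open>A\<close>, where its value is the Riemann
  integral over \<open>A\<close>, so it is a constant net. A constant net converges to its value, by the
  first axiom of net convergence, and to nothing else, by the Hausdorff property. Hence its limit
  is the Riemann integral.

  The only point needing care is that the Saks net is indexed by sets of points, so that its
  convergence is that of a copy with indices in \<open>'i\<close>. Every copy of a constant net is again
  a constant net (\<open>converges_constant_iff\<close>), and a copy of a net with one index always exists.
\<close>

lemma is_net_reindex:
  fixes x :: "('j, 'v) net" and e :: "'j \<Rightarrow> 'i"
  assumes x: "is_net x" and e: "inj_on e (net_idx x)"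
  shows "is_net (reindex_net e x)"
proof -
  have sub: "net_le x \<subseteq> net_idx x \<times> net_idx x"
    and refl: "\<And>i. i \<in> net_idx x \<Longrightarrow> (i, i) \<in> net_le x"
    and trans: "\<And>i j k. (i, j) \<in> net_le x \<Longrightarrow> (j, k) \<in> net_le x \<Longrightarrow> (i, k) \<in> net_le x"
    and ne: "net_idx x \<noteq> {}"
    and dir: "\<And>i j. i \<in> net_idx x \<Longrightarrow> j \<in> net_idx x \<Longrightarrow>
      \<exists>k\<in>net_idx x. (i, k) \<in> net_le x \<and> (j, k) \<in> net_le x"
    using x unfolding is_net_def directed_set_def preorder_on_def refl_on_def
    by (auto dest: transD)
  have le: "(e i, e j) \<in> map_prod e e ` net_le x" if "(i, j) \<in> net_le x" for i j
    using that by (metis image_eqI map_prod_simp)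
  have "refl_on (e ` net_idx x) (map_prod e e ` net_le x)"
    using refl le by (auto simp: refl_on_def)
  moreover have "map_prod e e ` net_le x \<subseteq> e ` net_idx x \<times> e ` net_idx x"
    using sub by auto
  moreover have "trans (map_prod e e ` net_le x)"
  proof (rule transI)
    fix p q r
    assume "(p, q) \<in> map_prod e e ` net_le x" "(q, r) \<in> map_prod e e ` net_le x"
    then obtain i j j' k where
      ij: "(i, j) \<in> net_le x" "p = e i" "q = e j" and
      jk: "(j', k) \<in> net_le x" "q = e j'" "r = e k"
      by auto
    have "j = j'"
      using ij jk sub e by (auto dest: inj_onD)
    with ij jk show "(p, r) \<in> map_prod e e ` net_le x"
      using trans le by blast
  qed
  moreover have "\<exists>k\<in>e ` net_idx x. (p, k) \<in> map_prod e e ` net_le x \<and> (q, k) \<in> map_prod e e ` net_le x"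
    if "p \<in> e ` net_idx x" "q \<in> e ` net_idx x" for p q
    using that dir le by blast
  ultimately show ?thesis
    using ne by (simp add: is_net_def directed_set_def preorder_on_def reindex_net_def)
qed

lemma net_convergence_constant:
  assumes "net_convergence \<eta>" and "is_net x" and "\<And>i. i \<in> net_idx x \<Longrightarrow> net_at x i = v"
  shows "x \<in> \<eta> v"
  using assms(1)[unfolded net_convergence_def, THEN conjunct2, THEN conjunct1] assms(2,3) by blast

text \<open>
  The injection is what makes a copy of the net with indices in \<open>'i\<close> available; without one,
  the net converges to nothing. Uniqueness holds across copies because each copy, being constant,
  also converges to \<open>v\<close>, so that limits need only be compared within one and the same copy.
\<close>

lemma converges_constant_iff:
  fixes x :: "('j, 'v) net" and \<eta> :: "'v \<Rightarrow> ('i, 'v) net set" and e :: "'j \<Rightarrow> 'i"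
  assumes conv: "net_convergence \<eta>" and haus: "net_hausdorff \<eta>"
    and net: "is_net x" and inj: "inj_on e (net_idx x)"
    and const: "\<And>i. i \<in> net_idx x \<Longrightarrow> net_at x i = v"
  shows "converges \<eta> x w \<longleftrightarrow> w = v"
proof -
  have copy: "reindex_net e' x \<in> \<eta> v" if e': "inj_on e' (net_idx x)" for e' :: "'j \<Rightarrow> 'i"
  proof (rule net_convergence_constant[OF conv is_net_reindex[OF net e']])
    fix k assume "k \<in> net_idx (reindex_net e' x)"
    then show "net_at (reindex_net e' x) k = v"
      using const by (auto simp: reindex_net_def inv_into_f_f[OF e'])
  qed
  show ?thesis
  proof
    assume "converges \<eta> x w"
    then obtain e' where "inj_on e' (net_idx x)" "reindex_net e' x \<in> \<eta> w"
      by (auto simp: converges_def)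
    with copy haus show "w = v"
      unfolding net_hausdorff_def by blast
  next
    assume "w = v"
    with copy[OF inj] net inj show "converges \<eta> x w"
      by (auto simp: converges_def)
  qed
qed

lemma is_net_saks_singleton: "is_net (saks_net \<N> \<eta> bul \<mu> f {A})"
  by (auto simp: is_net_def directed_set_def preorder_on_def saks_net_def refl_on_def trans_def)

theorem proposition6p1:
  fixes \<Omega> :: "'a set" and \<H> :: "'a set set"
    and \<N> :: "'a set \<Rightarrow> ('i, 'k, 'a) fss_net"
    and \<eta>1 :: "'x::real_vector \<Rightarrow> ('i, 'x) net set"
    and \<eta>2 :: "'y::real_vector \<Rightarrow> ('i, 'y) net set"
    and \<eta>3 :: "'z::real_vector \<Rightarrow> ('i, 'z) net set"
    and bul :: "'x \<Rightarrow> 'y \<Rightarrow> 'z"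
    and \<mu> :: "'a set \<Rightarrow> 'y" and f :: "'a \<Rightarrow> 'x" and A :: "'a set"
    and \<C> :: "('a \<Rightarrow> 'x) \<Rightarrow> 'a set \<Rightarrow> 'a set set"
  assumes "integration_structure \<Omega> \<H> \<N> \<eta>1 \<eta>2 \<eta>3 bul"
    and "A \<in> \<H>"
    and "riemann_integrable \<N> \<eta>3 bul \<mu> f A"
    and "\<C> f A = {A}"
  shows "saks_integrable \<H> \<N> \<eta>3 bul \<mu> \<C> f A \<and>
         saks_integral \<N> \<eta>3 bul \<mu> \<C> f A = riemann_integral \<N> \<eta>3 bul \<mu> f A"
proof -
  let ?S = "saks_net \<N> \<eta>3 bul \<mu> f {A}"
  have "net_convergence \<eta>3" "net_hausdorff \<eta>3"
    using assms(1) by (auto simp: integration_structure_def convergence_vector_space_def)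
  \<comment> \<open>On a one-point index set any map into \<open>'i\<close> is injective, so a copy exists
    however small \<open>'i\<close> is.\<close>
  then have lim: "converges \<eta>3 ?S w \<longleftrightarrow> w = riemann_integral \<N> \<eta>3 bul \<mu> f A" for w
    by (rule converges_constant_iff[OF _ _ is_net_saks_singleton, where e = "\<lambda>_. undefined"])
      (auto simp: saks_net_def)
  have "saks_class \<H> \<N> \<eta>3 bul \<mu> f {A}"
    using assms(2,3) by (simp add: saks_class_def)
  then show ?thesis
    using assms(4) lim by (simp add: saks_integrable_def saks_integral_def net_lim_def)
qed

end
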